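(* For every integer $n\ge 0$, $$ H_n\!\left( \tfrac34 \right) = \prod_{i=1}^n \frac{(2i-1)!\, (6i+1)!}{2\, (4i-1)!\, (4i+1)!}. $$
   Context: For $k\ge 0$ let $a_k(x)=\sum_{m=0}^{k}\binom{3k+1-m}{k-m}x^m$, and for $n\ge 0$ let $H_n(x)=\det[a_{i+j}(x)]_{0\le i,j\le n}$ be the $(n+1)\times(n+1)$ Hankel determinant. Empty products equal $1$. *)

theory Defs
  imports Complex_Main "Jordan_Normal_Form.Determinant"
begin

definition a_poly :: "nat \<Rightarrow> real \<Rightarrow> real" where
  "a_poly k x = (\<Sum>m=0..k. real ((3 * k + 1 - m) choose (k - m)) * x ^ m)"

definition hankel_H :: "nat \<Rightarrow> real \<Rightarrow> real" where
  "hankel_H n x = det (mat (n + 1) (n + 1) (\<lambda>(i, j). a_poly (i + j) x))"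

end

theory Submission
  imports Defs "HOL-Computational_Algebra.Formal_Power_Series"
begin

text \<open>
  Let \<open>A(t)\<close> be the generating function of the numbers \<open>a_k(3/4)\<close>. As \<open>a_k(x)\<close> is the coefficient of
  \<open>u^k\<close> in \<open>(1 - u)^(-2k-2) / (1 - x u)\<close>, Lagrange inversion for \<open>t = u (1 - u)^2\<close> turns its generating
  function into \<open>1 / ((1 - u) (1 - 3u) (1 - x u))\<close>. The value \<open>x = 3/4\<close> is special because
  \<open>1 - 27t/4 = (1 - 3u)^2 (1 - 3u/4)\<close>, so that the factor with \<open>x\<close> is absorbed by \<open>1 - 27t/4\<close>.
  The same substitution turns the generating functions of \<open>binom(3k, k)\<close> and of
  \<open>binom(3k, k) / (2k + 1)\<close> into \<open>1 / (1 - 3u)\<close> and \<open>1 / (1 - u)\<close>. These two series are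
  \<open>2F1(1/3, 2/3; 1/2; 27t/4)\<close> and \<open>2F1(1/3, 2/3; 3/2; 27t/4)\<close>, and therefore (lemma \<open>gf_quotient\<close>)
  \<open>A(t) (1 - 27t/4) 2F1(1/3, 2/3; 1/2; 27t/4) = 2F1(1/3, 2/3; 3/2; 27t/4)\<close>.

  A quotient of this kind has an explicit continued fraction of Gauss type. In terms of the series
  \<open>G_0 = (1 - 27t/4) 2F1(1/3, 2/3; 1/2; 27t/4)\<close> and
  \<open>G_(m+1) = 2F1(1/3 + m, 2/3 + m; 3/2 + 2m; 27t/4)\<close>, it amounts to the contiguous relations
  \<open>G_m = (1 - b_m t) G_(m+1) - l_m t^2 G_(m+2)\<close> (lemmas \<open>hyp_contiguous_base\<close> and
  \<open>hyp_contiguous\<close>). The Hankel determinants of \<open>A = G_1 / G_0\<close> are then products of the \<open>l_m\<close>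
  alone (theorem \<open>hankel_det_three_term\<close>), and the product of the first \<open>i\<close> of them telescopes to the
  \<open>i\<close>-th factor of the claimed formula.
\<close>

section \<open>Lagrange inversion for u(1 - u)^2\<close>

unbundle fps_syntax
no_notation vec_index (infixl "$" 100)

text \<open>The substitution \<open>t = u (1 - u)^2\<close> as a power series in \<open>u\<close>.\<close>

definition cubic :: "real fps" where
  "cubic = fps_X * (1 - fps_X)\<^sup>2"

lemma cubic_nth [simp]: "cubic $ 0 = 0" "cubic $ Suc 0 = 1"
  by (simp_all add: cubic_def fps_mult_nth power2_eq_square)

lemma inverse_one_minus_X_power_nth:
  "inverse ((1 - fps_X :: real fps) ^ Suc n) $ k = real ((n + k) choose k)"
  using one_minus_const_fps_X_neg_power'[of "Suc n" "1 :: real"] by simp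

lemma one_minus_3X_inverse_nth:
  "((1 - 3 * fps_X) * inverse ((1 - fps_X :: real fps) ^ Suc n)) $ Suc k =
     real ((n + Suc k) choose Suc k) - 3 * real ((n + k) choose k)"
proof -
  have "((1 - 3 * fps_X) * F) $ Suc k = F $ Suc k - 3 * F $ k" for F :: "real fps"
    by (simp add: left_diff_distrib mult.assoc numeral_fps_const)
  then show ?thesis
    using inverse_one_minus_X_power_nth by presburger
qed

lemma central_ternary_cancel: "((3 * Suc k) choose Suc k) = 3 * ((3 * k + 2) choose k)"
proof -
  have "Suc k * ((3 * Suc k) choose Suc k) = Suc k * (3 * ((3 * k + 2) choose k))"
  proof -
    have "3 * Suc k = Suc (3 * k + 2)" "Suc (3 * k + 2) = Suc k * 3" by simp_all
    then show ?thesis using Suc_times_binomial[of k "3 * k + 2"] by (simp only: mult.assoc)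
  qed
  then show ?thesis by (metis mult_cancel1 nat.distinct(1))
qed

lemma one_minus_3X_diagonal:
  "((1 - 3 * fps_X) * inverse ((1 - fps_X :: real fps) ^ Suc (2 * m))) $ m = (if m = 0 then 1 else 0)"
proof (cases m)
  case 0
  then show ?thesis by (simp add: fps_mult_nth)
next
  case (Suc k)
  have "((2 * m + Suc k) choose Suc k) = 3 * ((2 * m + k) choose k)"
  proof -
    have "2 * m + Suc k = 3 * Suc k" "2 * m + k = 3 * k + 2" using Suc by simp_all
    then show ?thesis by (simp only: central_ternary_cancel)
  qed
  then show ?thesis
    using one_minus_3X_inverse_nth[of "2 * m" k] Suc by (simp only: Suc) simp
qed

text \<open>
  The series \<open>(1 - 3u) (1 - u)^(-2k-1)\<close> are dual to the powers of \<open>u (1 - u)^2\<close>: pairing the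
  \<open>k\<close>-th one with the \<open>j\<close>-th power and extracting the coefficient of \<open>u^k\<close> yields the Kronecker delta.
  This is the whole content of Lagrange inversion in this case.
\<close>

lemma cubic_power_nth:
  "(cubic ^ j * ((1 - 3 * fps_X) * inverse ((1 - fps_X) ^ Suc (2 * k)))) $ k = (if j = k then 1 else 0)"
proof (cases "j \<le> k")
  case True
  then obtain m where m: "k = j + m" using le_Suc_ex by blast
  have "(1 - fps_X :: real fps) ^ (2 * j) * inverse ((1 - fps_X) ^ Suc (2 * k)) = 
        inverse ((1 - fps_X) ^ Suc (2 * m))" (is "?p * inverse ?q = inverse ?r")
  proof -
    have "?q = ?p * ?r" by (simp add: m flip: power_add)
    moreover have "?p * inverse ?p = 1"
      by (metis mult.commute inverse_mult_eq_1 fps_nth_power_0 diff_zero fps_sub_nth fps_one_nth fps_X_nth power_one zero_neq_one)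
    ultimately show ?thesis by (simp add: fps_inverse_mult)
  qed
  then have eq: "cubic ^ j * ((1 - 3 * fps_X) * inverse ((1 - fps_X) ^ Suc (2 * k))) =
     fps_X ^ j * ((1 - 3 * fps_X) * inverse ((1 - fps_X) ^ Suc (2 * m)))"
    unfolding cubic_def power_mult_distrib power_mult[symmetric]
    by (metis (no_types, opaque_lifting) mult.assoc mult.left_commute)
  show ?thesis
    unfolding eq using one_minus_3X_diagonal[of m] m by (simp add: fps_X_power_mult_nth del: power_Suc)
next
  case False
  then show ?thesis
    by (simp add: cubic_def power_mult_distrib mult.assoc fps_X_power_mult_nth)
qed

lemma lagrange_cubic:
  "((E oo cubic) * ((1 - 3 * fps_X) * inverse ((1 - fps_X) ^ Suc (2 * k)))) $ k = E $ k"
proof -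
  define Q :: "real fps" where "Q = (1 - 3 * fps_X) * inverse ((1 - fps_X) ^ Suc (2 * k))"
  have "((E oo cubic) * Q) $ k = (\<Sum>i=0..k. (\<Sum>j=0..k. E $ j * (cubic ^ j) $ i) * Q $ (k - i))"
    unfolding fps_mult_nth fps_compose_nth
    by (intro sum.cong refl arg_cong2[where f = "(*)"] sum.mono_neutral_left)
       (auto simp: startsby_zero_power_prefix)
  also have "\<dots> = (\<Sum>j=0..k. E $ j * (cubic ^ j * Q) $ k)"
    unfolding fps_mult_nth sum_distrib_right sum_distrib_left
    by (subst sum.swap) (simp add: mult.assoc)
  also have "\<dots> = (\<Sum>j=0..k. if j = k then E $ j else 0)"
    by (intro sum.cong) (simp_all add: Q_def cubic_power_nth del: power_Suc)
  also have "\<dots> = E $ k" by simp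
  finally show ?thesis by (simp add: Q_def)
qed

text \<open>
  The converse direction: the coefficients on the right-hand side determine the series that
  composes with \<open>u (1 - u)^2\<close> to \<open>\<psi>\<close>, since \<open>\<psi>\<close> can be written as such a composition by means of
  the compositional inverse.
\<close>

lemma compose_cubic_eqI:
  assumes "\<And>k. E $ k = (\<psi> * ((1 - 3 * fps_X) * inverse ((1 - fps_X) ^ Suc (2 * k)))) $ k"
  shows "E oo cubic = \<psi>"
proof -
  have "\<psi> oo fps_inv cubic oo cubic = \<psi> oo (fps_inv cubic oo cubic)"
    by (rule fps_compose_assoc[symmetric]) (simp_all add: fps_inv_def)
  also have "\<dots> = \<psi>" by (simp add: fps_inv)
  finally have *: "\<psi> oo fps_inv cubic oo cubic = \<psi>" .
  have "E = \<psi> oo fps_inv cubic"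
    by (rule fps_ext) (metis * assms lagrange_cubic)
  with * show ?thesis by simp
qed

section \<open>Generating functions\<close>

lemma fps_unit_inverse: "F $ 0 \<noteq> 0 \<Longrightarrow> F * inverse F = (1 :: real fps)"
  by (metis inverse_mult_eq_1 mult.commute)

lemma a_poly_conv:
  "a_poly k x = (inverse (1 - fps_const x * fps_X) * inverse ((1 - fps_X) ^ Suc (2 * k + 1))) $ k"
proof -
  have "inverse (1 - fps_const x * fps_X) $ m = x ^ m" for m
    using one_minus_const_fps_X_neg_power'[of 1 x] by simp
  moreover have "3 * k + 1 - m = 2 * k + 1 + (k - m)" if "m \<le> k" for m
    using that by simp
  ultimately show ?thesis
    unfolding a_poly_def fps_mult_nth inverse_one_minus_X_power_nth
    by (intro sum.cong) (simp_all add: mult.commute)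
qed

lemma gf_a_poly:
  "Abs_fps (\<lambda>k. a_poly k x) oo cubic =
     inverse ((1 - fps_X) * (1 - 3 * fps_X) * (1 - fps_const x * fps_X))"
proof (rule compose_cubic_eqI)
  fix k
  let ?x = "1 - fps_X :: real fps" and ?y = "1 - 3 * fps_X :: real fps" and ?z = "1 - fps_const x * fps_X"
  have "?x ^ Suc (2 * k + 1) = ?x * ?x ^ Suc (2 * k)"
    by simp
  then have "inverse (?x * ?y * ?z) * (?y * inverse (?x ^ Suc (2 * k))) =
      (?y * inverse ?y) * (inverse ?z * inverse (?x ^ Suc (2 * k + 1)))"
    by (simp only: fps_inverse_mult mult_ac)
  also have "?y * inverse ?y = 1"
    by (rule fps_unit_inverse) simp
  finally have "inverse (?x * ?y * ?z) * (?y * inverse (?x ^ Suc (2 * k))) = inverse ?z * inverse (?x ^ Suc (2 * k + 1))"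
    by simp
  then show "Abs_fps (\<lambda>k. a_poly k x) $ k = (inverse ((1 - fps_X) * (1 - 3 * fps_X) * (1 - fps_const x * fps_X)) *
      ((1 - 3 * fps_X) * inverse ((1 - fps_X) ^ Suc (2 * k)))) $ k"
    by (simp add: a_poly_conv)
qed

lemma gf_central_ternary:
  "Abs_fps (\<lambda>k. real ((3 * k) choose k)) oo cubic = inverse (1 - 3 * fps_X)"
proof (rule compose_cubic_eqI)
  fix k
  let ?y = "1 - 3 * fps_X :: real fps" and ?q = "inverse ((1 - fps_X :: real fps) ^ Suc (2 * k))"
  have "inverse ?y * (?y * ?q) = (?y * inverse ?y) * ?q"
    by (simp only: mult_ac)
  also have "?y * inverse ?y = 1"
    by (rule fps_unit_inverse) simp
  finally have "(inverse ?y * (?y * ?q)) $ k = real ((2 * k + k) choose k)"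
    by (simp only: mult_1_left inverse_one_minus_X_power_nth)
  moreover have "2 * k + k = 3 * k"
    by simp
  ultimately show "Abs_fps (\<lambda>k. real ((3 * k) choose k)) $ k = (inverse ?y * (?y * ?q)) $ k"
    by (simp only: fps_nth_Abs_fps)
qed

text \<open>The right-hand side is the number of ternary trees with \<open>k + 1\<close> inner nodes.\<close>

lemma ternary_tree_numbers:
  "real ((3 * Suc k + 1) choose Suc k) - 3 * real ((3 * Suc k) choose k) =
   real ((3 * Suc k) choose Suc k) / real (2 * Suc k + 1)"
proof -
  let ?c = "real ((3 * Suc k) choose Suc k)" and ?d = "real ((3 * Suc k) choose k)"
  have "(3 * Suc k + 1) choose Suc k = ((3 * Suc k) choose Suc k) + ((3 * Suc k) choose k)"
    unfolding Suc_eq_plus1[symmetric, of "3 * Suc k"] binomial_Suc_Suc by (rule add.commute)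
  then have 1: "real ((3 * Suc k + 1) choose Suc k) = ?c + ?d" by linarith
  have "Suc k * ((3 * Suc k) choose Suc k) = (3 * Suc k - k) * ((3 * Suc k) choose k)"
    using binomial_absorption[of k "3 * Suc k"] binomial_absorb_comp[of "3 * Suc k" k] by (simp only:)
  then have "real (Suc k) * ?c = real (3 * Suc k - k) * ?d"
    by (metis of_nat_mult)
  moreover have "real (Suc k) = real k + 1" "real (3 * Suc k - k) = 2 * real k + 3"
    by (simp_all add: of_nat_diff)
  ultimately have "(real k + 1) * ?c = (2 * real k + 3) * ?d"
    by (simp only:)
  then show ?thesis unfolding 1 by (simp add: field_simps)
qed

lemma gf_ternary_trees:
  "Abs_fps (\<lambda>k. real ((3 * k) choose k) / real (2 * k + 1)) oo cubic = inverse (1 - fps_X)"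
proof (rule compose_cubic_eqI)
  fix k
  have "inverse (1 - fps_X) * ((1 - 3 * fps_X) * inverse ((1 - fps_X :: real fps) ^ Suc (2 * k))) =
     (1 - 3 * fps_X) * inverse ((1 - fps_X) ^ Suc (2 * k + 1))"
    by (simp add: fps_inverse_mult mult_ac)
  moreover have "((1 - 3 * fps_X) * inverse ((1 - fps_X :: real fps) ^ Suc (2 * k + 1))) $ k =
     real ((3 * k) choose k) / real (2 * k + 1)"
  proof (cases k)
    case 0
    then show ?thesis by (simp add: fps_mult_nth)
  next
    case (Suc m)
    have "2 * Suc m + 1 + Suc m = 3 * Suc m + 1" "2 * Suc m + 1 + m = 3 * Suc m" by simp_all
    then show ?thesis unfolding Suc one_minus_3X_inverse_nth using ternary_tree_numbers[of m] by presburger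
  qed
  ultimately show "Abs_fps (\<lambda>k. real ((3 * k) choose k) / real (2 * k + 1)) $ k =
    (inverse (1 - fps_X) * ((1 - 3 * fps_X) * inverse ((1 - fps_X :: real fps) ^ Suc (2 * k)))) $ k"
    by (simp only: fps_nth_Abs_fps)
qed

lemma gf_quotient:
  "Abs_fps (\<lambda>k. a_poly k (3 / 4)) *
     ((1 - fps_const (27 / 4) * fps_X) * Abs_fps (\<lambda>k. real ((3 * k) choose k))) =
   Abs_fps (\<lambda>k. real ((3 * k) choose k) / real (2 * k + 1))" (is "?A * (?L * ?C) = ?g")
proof -
  let ?x = "1 - fps_X :: real fps" and ?y = "1 - 3 * fps_X :: real fps"
    and ?z = "1 - fps_const (3 / 4) * fps_X :: real fps"
  have "?L oo cubic = 1 - fps_const (27 / 4) * cubic"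
    by (simp add: fps_compose_sub_distrib fps_compose_mult_distrib)
  also have "\<dots> = ?y * ?y * ?z"
  proof -
    define e where "e = fps_const (3 / 4 :: real)"
    \<comment> \<open>Both sides agree up to a multiple of \<open>3 - 4 e\<close>, which vanishes for \<open>e = 3/4\<close>.\<close>
    have e9: "fps_const (27 / 4 :: real) = 9 * e" and e4: "4 * e = 3"
      by (simp_all add: e_def numeral_fps_const)
    have "1 - fps_const (27 / 4) * cubic = ?y * ?y * (1 - e * fps_X) + (3 - 4 * e) * (2 * fps_X - 3 * fps_X\<^sup>2)"
      unfolding e9 cubic_def by (simp add: algebra_simps power2_eq_square)
    then show ?thesis unfolding e4 by (simp add: e_def)
  qed
  finally have "?A * (?L * ?C) oo cubic = inverse (?x * ?y * ?z) * (?y * ?y * ?z * inverse ?y)"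
    by (simp add: fps_compose_mult_distrib gf_a_poly gf_central_ternary)
  also have "\<dots> = inverse ?x * (?y * inverse ?y) * (?y * inverse ?y) * (?z * inverse ?z)"
    by (simp add: fps_inverse_mult mult_ac)
  also have "\<dots> = inverse ?x" by (simp add: fps_unit_inverse)
  also have "\<dots> = ?g oo cubic" by (rule gf_ternary_trees[symmetric])
  finally show ?thesis using fps_compose_inj_right[of cubic] by simp
qed

section \<open>Contiguous hypergeometric series\<close>

text \<open>The Gauss hypergeometric series \<open>2F1(a, b; c; r t)\<close> as a power series in \<open>t\<close>.\<close>

definition hyp :: "real \<Rightarrow> real \<Rightarrow> real \<Rightarrow> real \<Rightarrow> real fps" where
  "hyp a b c r = Abs_fps (\<lambda>k. pochhammer a k * pochhammer b k / (pochhammer c k * fact k) * r ^ k)"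

lemma hyp_nth: "hyp a b c r $ k = pochhammer a k * pochhammer b k / (pochhammer c k * fact k) * r ^ k"
  by (simp add: hyp_def)

text \<open>
  The coefficient of \<open>t^2\<close> in the contiguous relation whose middle term is \<open>2F1(a, b; c; t)\<close>. It is the
  product of the consecutive coefficients \<open>a b / ((c - 1) c)\<close> and \<open>(c - a) (c - b) / (c (c + 1))\<close> of a
  continued fraction of Gauss in the variable \<open>t / (t - 1)\<close>.
\<close>

definition gauss_coeff :: "real \<Rightarrow> real \<Rightarrow> real \<Rightarrow> real" where
  "gauss_coeff a b c = a * b * (c - a) * (c - b) / ((c - 1) * c\<^sup>2 * (c + 1))"

lemma three_term_nth:
  fixes F G :: "real fps"
  shows "((1 - fps_const \<beta> * fps_X) * F - fps_const \<kappa> * fps_X\<^sup>2 * G) $ 0 = F $ 0"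
    and "((1 - fps_const \<beta> * fps_X) * F - fps_const \<kappa> * fps_X\<^sup>2 * G) $ Suc 0 = F $ Suc 0 - \<beta> * F $ 0"
    and "((1 - fps_const \<beta> * fps_X) * F - fps_const \<kappa> * fps_X\<^sup>2 * G) $ Suc (Suc j) =
           F $ Suc (Suc j) - \<beta> * F $ Suc j - \<kappa> * G $ j"
  by (simp_all add: left_diff_distrib mult.assoc fps_X_power_mult_nth numeral_2_eq_2 del: power_Suc)

lemma pochhammer_Suc_Suc:
  fixes a :: real
  shows "pochhammer a (Suc (Suc j)) = a * (a + 1) * pochhammer (a + 2) j"
    and "pochhammer a (Suc (Suc j)) = a * pochhammer (a + 1) j * (a + 1 + real j)"
proof -
  show "pochhammer a (Suc (Suc j)) = a * (a + 1) * pochhammer (a + 2) j"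
    unfolding pochhammer_rec by (simp add: add.assoc)
  show "pochhammer a (Suc (Suc j)) = a * pochhammer (a + 1) j * (a + 1 + real j)"
    unfolding pochhammer_rec[of a] pochhammer_Suc[of "a + 1"] by simp
qed

text \<open>
  The contiguous relations below are identities between coefficients that all are rational multiples
  of one quantity \<open>t\<close>. Over a common denominator \<open>D\<close>, and after removal of a common factor \<open>K\<close>, only a
  polynomial identity remains.
\<close>

lemma scaled_three_term:
  fixes K :: real
  assumes l: "l = K * L / D" and m: "m = K * M / D" and n: "n * u = K * N / D" and p: "p = K * P / D"
    and L: "L = M - N - P"
  shows "l * t = m * t - n * (u * t) - p * t"
proof -
  have "l = m - n * u - p"
    unfolding l m n p L by (simp only: right_diff_distrib diff_divide_distrib)
  then show ?thesis by (simp add: left_diff_distrib)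
qed

text \<open>
  All three parameter triples shift by \<open>(1, 1, 2)\<close>. The coefficient of \<open>t\<close> is forced by comparison of
  the linear terms.
\<close>

lemma hyp_contiguous:
  assumes c: "c > 0"
  shows "hyp a b c r =
     (1 - fps_const (((a + 1) * (b + 1) / (c + 2) - a * b / c) * r) * fps_X) * hyp (a + 1) (b + 1) (c + 2) r
     - fps_const (gauss_coeff (a + 1) (b + 1) (c + 2) * r\<^sup>2) * fps_X\<^sup>2 * hyp (a + 2) (b + 2) (c + 4) r"
    (is "_ = ?rhs")
proof (rule fps_ext)
  fix k
  consider "k = 0" | "k = 1" | j where "k = Suc (Suc j)"
    by (metis One_nat_def not0_implies_Suc)
  then show "hyp a b c r $ k = ?rhs $ k"
  proof cases
    case 1
    then show ?thesis by (simp add: three_term_nth hyp_nth)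
  next
    case 2
    then show ?thesis by (simp add: three_term_nth hyp_nth algebra_simps)
  next
    case (3 j)
    define p where "p = pochhammer (a + 2) j * pochhammer (b + 2) j"
    define q where "q = pochhammer (c + 4) j"
    define x where "x = real j"
    have pos: "q > 0" "x \<ge> 0" using c by (auto simp: q_def x_def intro: pochhammer_pos)
    have e: "pochhammer (d + 1) (Suc (Suc j)) = (d + 1) * pochhammer (d + 2) j * (d + 2 + x)"
            "pochhammer (d + 1) (Suc j) = (d + 1) * pochhammer (d + 2) j"
            "pochhammer d (Suc (Suc j)) = d * (d + 1) * pochhammer (d + 2) j" for d
      using pochhammer_Suc_Suc[of d j] pochhammer_Suc_Suc(2)[of "d + 1" j] pochhammer_rec[of "d + 1" j]
      by (simp_all add: add.assoc x_def)
    have c2: "pochhammer (c + 2) (Suc (Suc j)) = (c + 2) * (c + 3) * q"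
      using pochhammer_Suc_Suc(1)[of "c + 2" j] by (simp add: q_def add.assoc)
    have nz: "c \<noteq> 0" "c + 1 \<noteq> 0" "c + 2 \<noteq> 0" "c + 3 \<noteq> 0" "c + 2 + x \<noteq> 0" "c + 3 + x \<noteq> 0" "x + 1 \<noteq> 0" "x + 2 \<noteq> 0"
      using pos c by auto
    have "c + 3 + x = c + 2 + real (Suc j)" by (simp add: x_def)
    then have "pochhammer (c + 2) (Suc j) * (c + 3 + x) = (c + 2) * (c + 3) * q"
      using c2 pochhammer_Suc[of "c + 2" "Suc j"] by metis
    then have c1: "pochhammer (c + 2) (Suc j) = (c + 2) * (c + 3) * q / (c + 3 + x)"
      using nz by (simp add: eq_divide_eq)
    have "pochhammer (c + 2) j * (c + 2 + x) = pochhammer (c + 2) (Suc j)"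
      by (simp add: pochhammer_Suc x_def)
    then have "pochhammer (c + 2) j = (c + 2) * (c + 3) * q / ((c + 3 + x) * (c + 2 + x))"
      unfolding c1 using nz by (simp add: eq_divide_eq mult_ac)
    then have c0: "pochhammer c (Suc (Suc j)) = c * (c + 1) * (c + 2) * (c + 3) * q / ((c + 3 + x) * (c + 2 + x))"
      by (simp add: e(3))
    have f: "fact (Suc (Suc j)) = (x + 2) * (x + 1) * (fact j :: real)" "fact (Suc j) = (x + 1) * (fact j :: real)"
      by (simp_all add: x_def algebra_simps)
    \<comment> \<open>\<open>t\<close> is \<open>r^2\<close> times the coefficient of the last series, in which all others are expressed.\<close>
    define t where "t = p / (q * fact j) * r ^ j * r\<^sup>2"
    have h0: "hyp a b c r $ Suc (Suc j) =
       a * (a + 1) * b * (b + 1) * (c + 3 + x) * (c + 2 + x) / (c * (c + 1) * (c + 2) * (c + 3) * (x + 2) * (x + 1)) * t"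
      unfolding hyp_nth c0 f e(3)[of a] e(3)[of b] t_def p_def by (simp add: power2_eq_square mult_ac)
    have h1: "hyp (a + 1) (b + 1) (c + 2) r $ Suc (Suc j) =
       (a + 1) * (a + 2 + x) * (b + 1) * (b + 2 + x) / ((c + 2) * (c + 3) * (x + 2) * (x + 1)) * t"
      unfolding hyp_nth c2 f e(1)[of a] e(1)[of b] t_def p_def by (simp add: power2_eq_square mult_ac)
    have h2: "r * hyp (a + 1) (b + 1) (c + 2) r $ Suc j =
       (a + 1) * (b + 1) * (c + 3 + x) / ((c + 2) * (c + 3) * (x + 1)) * t"
      unfolding hyp_nth c1 f e(2)[of a] e(2)[of b] t_def p_def by (simp add: power2_eq_square mult_ac)
    have h3: "r\<^sup>2 * hyp (a + 2) (b + 2) (c + 4) r $ j = t"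
      unfolding hyp_nth t_def p_def q_def by (simp add: power2_eq_square)
    have "a * (a + 1) * b * (b + 1) * (c + 3 + x) * (c + 2 + x) / (c * (c + 1) * (c + 2) * (c + 3) * (x + 2) * (x + 1)) * t =
      (a + 1) * (a + 2 + x) * (b + 1) * (b + 2 + x) / ((c + 2) * (c + 3) * (x + 2) * (x + 1)) * t -
      ((a + 1) * (b + 1) / (c + 2) - a * b / c) * ((a + 1) * (b + 1) * (c + 3 + x) / ((c + 2) * (c + 3) * (x + 1)) * t) -
      gauss_coeff (a + 1) (b + 1) (c + 2) * t" (is "?l * t = ?m * t - ?n * (?o * t) - ?g * t")
    proof (rule scaled_three_term)
      define D where "D = c * (c + 1) * (c + 2)\<^sup>2 * (c + 3) * (x + 1) * (x + 2)"
      define K where "K = (a + 1) * (b + 1)"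
      note frac = frac_eq_eq mult_eq_0_iff power2_eq_square nz simp_thms mult_ac D_def K_def
      show "?l = K * (a * b * (c + 3 + x) * (c + 2 + x) * (c + 2)) / D"
        by (simp only: frac)
      show "?m = K * ((a + 2 + x) * (b + 2 + x) * c * (c + 1) * (c + 2)) / D"
        by (simp only: frac)
      show "?n * ?o = K * (((a + 1) * (b + 1) * c - a * b * (c + 2)) * (c + 3 + x) * (x + 2) * (c + 1)) / D"
      proof -
        have "?n = ((a + 1) * (b + 1) * c - a * b * (c + 2)) / ((c + 2) * c)"
          by (rule diff_frac_eq) (use nz in auto)
        then show ?thesis by (simp only: times_divide_times_eq frac)
      qed
      show "?g = K * ((c + 1 - a) * (c + 1 - b) * c * (x + 1) * (x + 2)) / D"
      proof -
        have "?g = (a + 1) * (b + 1) * (c + 1 - a) * (c + 1 - b) / ((c + 1) * (c + 2)\<^sup>2 * (c + 3))"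
          unfolding gauss_coeff_def by (intro arg_cong2[where f = "(/)"] arg_cong2[where f = "(*)"]) simp_all
        then show ?thesis by (simp only: frac)
      qed
      show "a * b * (c + 3 + x) * (c + 2 + x) * (c + 2) =
          (a + 2 + x) * (b + 2 + x) * c * (c + 1) * (c + 2)
          - ((a + 1) * (b + 1) * c - a * b * (c + 2)) * (c + 3 + x) * (x + 2) * (c + 1)
          - (c + 1 - a) * (c + 1 - b) * c * (x + 1) * (x + 2)"
        by (simp add: algebra_simps)
    qed
    then show ?thesis
      unfolding 3 three_term_nth mult.assoc[of _ r] mult.assoc[of _ "r\<^sup>2"] h2 h3 h0 h1 .
  qed
qed

text \<open>
  The first step of the continued fraction is different: the lower parameter rises by one, and the
  factor \<open>1 - r t\<close> appears.
\<close>

lemma hyp_contiguous_base: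
  assumes c: "c > 0"
  shows "(1 - fps_const r * fps_X) * hyp a b c r =
     (1 - fps_const ((1 - a * b / (c * (c + 1))) * r) * fps_X) * hyp a b (c + 1) r
     - fps_const (gauss_coeff a b (c + 1) * r\<^sup>2) * fps_X\<^sup>2 * hyp (a + 1) (b + 1) (c + 3) r"
    (is "?lhs = ?rhs")
proof (rule fps_ext)
  fix k
  have L: "?lhs $ 0 = hyp a b c r $ 0" "?lhs $ Suc i = hyp a b c r $ Suc i - r * hyp a b c r $ i" for i
    by (simp_all add: left_diff_distrib mult.assoc)
  consider "k = 0" | "k = 1" | j where "k = Suc (Suc j)"
    by (metis One_nat_def not0_implies_Suc)
  then show "?lhs $ k = ?rhs $ k"
  proof cases
    case 1
    then show ?thesis by (simp add: three_term_nth hyp_nth L)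
  next
    case 2
    have "a * b / c * r - r = a * b / (c + 1) * r - (1 - a * b / (c * (c + 1))) * r"
      using c by (simp add: divide_simps) (simp add: algebra_simps)
    with 2 show ?thesis unfolding One_nat_def 2 three_term_nth L hyp_nth by simp
  next
    case (3 j)
    define p where "p = pochhammer (a + 1) j * pochhammer (b + 1) j"
    define q where "q = pochhammer (c + 3) j"
    define x where "x = real j"
    have pos: "q > 0" "x \<ge> 0" using c by (auto simp: q_def x_def intro: pochhammer_pos)
    have e: "pochhammer d (Suc (Suc j)) = d * pochhammer (d + 1) j * (d + 1 + x)"
            "pochhammer d (Suc j) = d * pochhammer (d + 1) j" for d
      using pochhammer_Suc_Suc(2)[of d j] pochhammer_rec[of d j] by (simp_all add: x_def)
    have c2: "pochhammer (c + 1) (Suc (Suc j)) = (c + 1) * (c + 2) * q"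
      using pochhammer_Suc_Suc(1)[of "c + 1" j] by (simp add: q_def add.assoc)
    have nz: "c \<noteq> 0" "c + 1 \<noteq> 0" "c + 2 \<noteq> 0" "c + 1 + x \<noteq> 0" "c + 2 + x \<noteq> 0" "x + 1 \<noteq> 0" "x + 2 \<noteq> 0"
      using pos c by auto
    have "c + 2 + x = c + 1 + real (Suc j)" by (simp add: x_def)
    then have "pochhammer (c + 1) (Suc j) * (c + 2 + x) = (c + 1) * (c + 2) * q"
      using c2 pochhammer_Suc[of "c + 1" "Suc j"] by metis
    then have c1: "pochhammer (c + 1) (Suc j) = (c + 1) * (c + 2) * q / (c + 2 + x)"
      using nz by (simp add: eq_divide_eq)
    have "pochhammer (c + 1) j * (c + 1 + x) = pochhammer (c + 1) (Suc j)"
      by (simp add: pochhammer_Suc x_def)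
    then have c0: "pochhammer (c + 1) j = (c + 1) * (c + 2) * q / ((c + 2 + x) * (c + 1 + x))"
      unfolding c1 using nz by (simp add: eq_divide_eq mult_ac)
    have d2: "pochhammer c (Suc (Suc j)) = c * (c + 1) * (c + 2) * q / (c + 2 + x)"
      using c1 by (simp add: pochhammer_rec[of c])
    have d1: "pochhammer c (Suc j) = c * (c + 1) * (c + 2) * q / ((c + 2 + x) * (c + 1 + x))"
      using c0 by (simp add: pochhammer_rec[of c])
    have f: "fact (Suc (Suc j)) = (x + 2) * (x + 1) * (fact j :: real)" "fact (Suc j) = (x + 1) * (fact j :: real)"
      by (simp_all add: x_def algebra_simps)
    \<comment> \<open>\<open>t\<close> is \<open>r^2\<close> times the coefficient of the last series, in which all others are expressed.\<close>
    define t where "t = p / (q * fact j) * r ^ j * r\<^sup>2"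
    have g2: "hyp a b c r $ Suc (Suc j) =
       a * (a + 1 + x) * b * (b + 1 + x) * (c + 2 + x) / (c * (c + 1) * (c + 2) * (x + 2) * (x + 1)) * t"
      unfolding hyp_nth d2 f e(1)[of a] e(1)[of b] t_def p_def by (simp add: power2_eq_square mult_ac)
    have g1: "r * hyp a b c r $ Suc j =
       a * b * (c + 2 + x) * (c + 1 + x) / (c * (c + 1) * (c + 2) * (x + 1)) * t"
      unfolding hyp_nth d1 f e(2)[of a] e(2)[of b] t_def p_def by (simp add: power2_eq_square mult_ac)
    have h1: "hyp a b (c + 1) r $ Suc (Suc j) =
       a * (a + 1 + x) * b * (b + 1 + x) / ((c + 1) * (c + 2) * (x + 2) * (x + 1)) * t"
      unfolding hyp_nth c2 f e(1)[of a] e(1)[of b] t_def p_def by (simp add: power2_eq_square mult_ac)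
    have h2: "r * hyp a b (c + 1) r $ Suc j =
       a * b * (c + 2 + x) / ((c + 1) * (c + 2) * (x + 1)) * t"
      unfolding hyp_nth c1 f e(2)[of a] e(2)[of b] t_def p_def by (simp add: power2_eq_square mult_ac)
    have h3: "r\<^sup>2 * hyp (a + 1) (b + 1) (c + 3) r $ j = t"
      unfolding hyp_nth t_def p_def q_def by (simp add: power2_eq_square)
    have "(a * (a + 1 + x) * b * (b + 1 + x) * (c + 2 + x) / (c * (c + 1) * (c + 2) * (x + 2) * (x + 1)) -
       a * b * (c + 2 + x) * (c + 1 + x) / (c * (c + 1) * (c + 2) * (x + 1))) * t =
       a * (a + 1 + x) * b * (b + 1 + x) / ((c + 1) * (c + 2) * (x + 2) * (x + 1)) * t -
      (1 - a * b / (c * (c + 1))) * (a * b * (c + 2 + x) / ((c + 1) * (c + 2) * (x + 1)) * t) -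
      gauss_coeff a b (c + 1) * t" (is "(?k - ?l) * t = ?m * t - ?n * (?o * t) - ?g * t")
    proof (rule scaled_three_term)
      define D where "D = c * (c + 1)\<^sup>2 * (c + 2) * (x + 1) * (x + 2)"
      define K where "K = a * b"
      note frac = frac_eq_eq mult_eq_0_iff power2_eq_square nz simp_thms mult_ac D_def K_def
      have "?k = K * ((a + 1 + x) * (b + 1 + x) * (c + 2 + x) * (c + 1)) / D"
        by (simp only: frac)
      moreover have "?l = K * ((c + 2 + x) * (c + 1 + x) * (c + 1) * (x + 2)) / D"
        by (simp only: frac)
      ultimately show "?k - ?l = K * ((a + 1 + x) * (b + 1 + x) * (c + 2 + x) * (c + 1)
          - (c + 2 + x) * (c + 1 + x) * (c + 1) * (x + 2)) / D"
        by (metis right_diff_distrib diff_divide_distrib)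
      show "?m = K * ((a + 1 + x) * (b + 1 + x) * c * (c + 1)) / D"
        by (simp only: frac)
      show "?n * ?o = K * ((c * (c + 1) - a * b) * (c + 2 + x) * (x + 2)) / D"
      proof -
        have "?n = (c * (c + 1) - a * b) / (c * (c + 1))"
          using nz by (simp add: diff_divide_distrib)
        then show ?thesis by (simp only: times_divide_times_eq frac)
      qed
      show "?g = K * ((c + 1 - a) * (c + 1 - b) * (x + 1) * (x + 2)) / D"
      proof -
        have "?g = a * b * (c + 1 - a) * (c + 1 - b) / (c * (c + 1)\<^sup>2 * (c + 2))"
          by (simp add: gauss_coeff_def add.assoc)
        then show ?thesis by (simp only: frac)
      qed
      show "(a + 1 + x) * (b + 1 + x) * (c + 2 + x) * (c + 1) - (c + 2 + x) * (c + 1 + x) * (c + 1) * (x + 2) =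
          (a + 1 + x) * (b + 1 + x) * c * (c + 1) - (c * (c + 1) - a * b) * (c + 2 + x) * (x + 2)
          - (c + 1 - a) * (c + 1 - b) * (x + 1) * (x + 2)"
        by (simp add: algebra_simps)
    qed
    then have "?k * t - ?l * t = ?m * t - ?n * (?o * t) - ?g * t" by (simp only: left_diff_distrib[of _ _ t])
    then show ?thesis
      unfolding 3 three_term_nth L mult.assoc[of _ r] mult.assoc[of _ "r\<^sup>2"] g1 g2 h2 h3 h1 .
  qed
qed

section \<open>Hankel determinants\<close>

text \<open>
  Pade approximants of \<open>A = G_1 / G_0\<close>: a polynomial \<open>E\<close> of degree at most \<open>n\<close> and a polynomial \<open>N\<close> of
  degree less than \<open>n\<close> such that \<open>E A - N\<close> has order at least \<open>2 n\<close>. The reversed polynomials \<open>E\<close> are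
  the orthogonal polynomials for the moments \<open>A $ k\<close>, and they satisfy the three-term recurrence with
  the coefficients \<open>b\<close> and \<open>l\<close>.
\<close>

lemma pade_exists:
  fixes G :: "nat \<Rightarrow> 'a :: comm_ring_1 fps"
  assumes step: "\<And>n. G n = (1 - fps_const (b n) * fps_X) * G (Suc n) - fps_const (l n) * fps_X\<^sup>2 * G (Suc (Suc n))"
    and start: "A * G 0 = G (Suc 0)"
  shows "\<exists>E N. (\<forall>k>n. E $ k = 0) \<and> (\<forall>k\<ge>n. N $ k = 0) \<and> E $ 0 = 1 \<and>
     (E * A - N) * G 0 = fps_const (\<Prod>j<n. l j) * fps_X ^ (2 * n) * G (Suc n)"
proof (induction n rule: induct_nat_012)
  case 0
  show ?case by (rule exI[of _ 1], rule exI[of _ 0]) (simp add: start)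
next
  case 1
  have "((1 - fps_const (b 0) * fps_X) * A - 1) * G 0 = (1 - fps_const (b 0) * fps_X) * G (Suc 0) - G 0"
    by (simp add: algebra_simps flip: start)
  also have "\<dots> = fps_const (l 0) * fps_X\<^sup>2 * G (Suc (Suc 0))"
    by (subst (2) step) simp
  finally show ?case
    by (intro exI[of _ "1 - fps_const (b 0) * fps_X"] exI[of _ 1]) (simp add: numeral_2_eq_2)
next
  case (ge2 n)
  obtain E N where E: "\<forall>k>n. E $ k = 0" "\<forall>k\<ge>n. N $ k = 0" "E $ 0 = 1"
     "(E * A - N) * G 0 = fps_const (\<Prod>j<n. l j) * fps_X ^ (2 * n) * G (Suc n)"
    using ge2(1) by blast
  obtain E' N' where E': "\<forall>k>Suc n. E' $ k = 0" "\<forall>k\<ge>Suc n. N' $ k = 0" "E' $ 0 = 1"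
     "(E' * A - N') * G 0 = fps_const (\<Prod>j<Suc n. l j) * fps_X ^ (2 * Suc n) * G (Suc (Suc n))"
    using ge2(2) by blast
  define B where "B = 1 - fps_const (b (Suc n)) * fps_X"
  define D where "D = fps_const (l n) * fps_X\<^sup>2"
  define \<Lambda> where "\<Lambda> = (\<Prod>j<Suc n. l j)"
  have nth: "(B * F - D * H) $ k = F $ k - (if k = 0 then 0 else b (Suc n) * F $ (k - 1)) 
       - (if k < 2 then 0 else l n * H $ (k - 2))" for F H k
    by (simp add: B_def D_def left_diff_distrib mult.assoc fps_X_power_mult_nth)
  have "((B * E' - D * E) * A - (B * N' - D * N)) * G 0 = 
      B * ((E' * A - N') * G 0) - D * ((E * A - N) * G 0)"
    by (simp add: algebra_simps)
  also have "\<dots> = B * (fps_const \<Lambda> * fps_X ^ (2 * Suc n) * G (Suc (Suc n))) -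
      D * (fps_const (\<Prod>j<n. l j) * fps_X ^ (2 * n) * G (Suc n))"
    unfolding E(4) E'(4) \<Lambda>_def ..
  also have "D * (fps_const (\<Prod>j<n. l j) * fps_X ^ (2 * n) * G (Suc n)) =
      fps_const \<Lambda> * fps_X ^ (2 * Suc n) * G (Suc n)"
  proof -
    have "fps_const \<Lambda> = fps_const (\<Prod>j<n. l j) * fps_const (l n)" by (simp add: \<Lambda>_def)
    then show ?thesis
      unfolding D_def power_add mult_Suc_right power2_eq_square by (simp only: mult_ac)
  qed
  also have "B * (fps_const \<Lambda> * fps_X ^ (2 * Suc n) * G (Suc (Suc n))) - \<dots> =
      fps_const \<Lambda> * fps_X ^ (2 * Suc n) * (B * G (Suc (Suc n)) - G (Suc n))"
    by (simp add: algebra_simps)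
  also have "B * G (Suc (Suc n)) - G (Suc n) = fps_const (l (Suc n)) * fps_X\<^sup>2 * G (Suc (Suc (Suc n)))"
    by (subst (2) step) (simp add: B_def)
  also have "fps_const \<Lambda> * fps_X ^ (2 * Suc n) * (fps_const (l (Suc n)) * fps_X\<^sup>2 * G (Suc (Suc (Suc n)))) =
     fps_const (\<Prod>j<Suc (Suc n). l j) * fps_X ^ (2 * Suc (Suc n)) * G (Suc (Suc (Suc n)))"
  proof -
    have "fps_const (\<Prod>j<Suc (Suc n). l j) = fps_const \<Lambda> * fps_const (l (Suc n))" by (simp add: \<Lambda>_def)
    then show ?thesis
      unfolding power_add mult_Suc_right[of _ "Suc n"] power2_eq_square by (simp only: mult_ac)
  qed
  finally have eq: "((B * E' - D * E) * A - (B * N' - D * N)) * G 0 = \<dots>" .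
  show ?case
  proof (rule exI[of _ "B * E' - D * E"], rule exI[of _ "B * N' - D * N"], intro conjI)
    show "\<forall>k>Suc (Suc n). (B * E' - D * E) $ k = 0" using E E' by (auto simp: nth simp del: fps_sub_nth)
    show "\<forall>k\<ge>Suc (Suc n). (B * N' - D * N) $ k = 0" using E E' by (auto simp: nth simp del: fps_sub_nth)
    show "(B * E' - D * E) $ 0 = 1" using E' by (simp add: nth del: fps_sub_nth)
  qed (rule eq)
qed

text \<open>
  Multiplication of the Hankel matrix by the unitriangular matrix of coefficients of the orthogonal
  polynomials makes it lower triangular, with the leading coefficients of \<open>E A - N\<close> on the diagonal.
\<close>

theorem hankel_det_three_term:
  fixes G :: "nat \<Rightarrow> 'a :: field fps"
  assumes step: "\<And>n. G n = (1 - fps_const (b n) * fps_X) * G (Suc n) - fps_const (l n) * fps_X\<^sup>2 * G (Suc (Suc n))"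
    and start: "A * G 0 = G (Suc 0)"
    and unit: "\<And>n. G n $ 0 = 1"
  shows "det (mat (n + 1) (n + 1) (\<lambda>(i, j). A $ (i + j))) = (\<Prod>i\<le>n. \<Prod>j<i. l j)"
proof -
  define \<Lambda> where "\<Lambda> m = (\<Prod>j<m. l j)" for m
  obtain E N where E: "\<And>m k. k > m \<Longrightarrow> E m $ k = 0" and N: "\<And>m k. k \<ge> m \<Longrightarrow> N m $ k = 0" and E0: "\<And>m. E m $ 0 = 1"
    and eq: "\<And>m. (E m * A - N m) * G 0 = fps_const (\<Lambda> m) * fps_X ^ (2 * m) * G (Suc m)"
    using pade_exists[OF step start] unfolding \<Lambda>_def by metis
  \<comment> \<open>The degree bound on \<open>N m\<close> makes it invisible in the coefficients from \<open>m\<close> on.\<close>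
  have co: "(E m * A) $ (i + m) = (if i < m then 0 else \<Lambda> m)" if "i \<le> m" for i m
  proof -
    have "inverse (G 0) * G 0 = 1" by (simp add: unit inverse_mult_eq_1)
    then have "E m * A - N m = (E m * A - N m) * G 0 * inverse (G 0)" by (metis mult.assoc mult.commute mult_1_right)
    also have "\<dots> = fps_X ^ (2 * m) * (fps_const (\<Lambda> m) * (G (Suc m) * inverse (G 0)))"
      unfolding eq by (simp add: mult_ac)
    finally have "(E m * A - N m) $ (i + m) = (if i < m then 0 else \<Lambda> m)"
      using that by (auto simp: fps_X_power_mult_nth unit)
    then show ?thesis by (simp add: N)
  qed
  let ?d = "n + 1"
  define M where "M = mat ?d ?d (\<lambda>(i, j). A $ (i + j))"
  define U where "U = mat ?d ?d (\<lambda>(j, m). if j \<le> m then E m $ (m - j) else 0)"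
  have MU: "(M * U) $$ (i, m) = (E m * A) $ (i + m)" if "i < ?d" "m < ?d" for i m
  proof -
    have "(M * U) $$ (i, m) = (\<Sum>j\<in>{0..<?d}. A $ (i + j) * (if j \<le> m then E m $ (m - j) else 0))"
      using that by (simp add: M_def U_def scalar_prod_def)
    also have "\<dots> = (\<Sum>j=0..m. A $ (i + j) * E m $ (m - j))"
      using that by (intro sum.mono_neutral_cong_right) auto
    also have "\<dots> = (\<Sum>s=0..m. E m $ s * A $ (i + m - s))"
      by (rule sum.reindex_bij_witness[of _ "\<lambda>s. m - s" "\<lambda>s. m - s"]) auto
    also have "\<dots> = (\<Sum>s=0..i + m. E m $ s * A $ (i + m - s))"
      by (intro sum.mono_neutral_left) (auto simp: E)
    finally show ?thesis by (simp add: fps_mult_nth)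
  qed
  have carr: "M \<in> carrier_mat ?d ?d" "U \<in> carrier_mat ?d ?d" by (simp_all add: M_def U_def)
  have "det M * det U = det (M * U)" using carr by (simp add: det_mult)
  also have "\<dots> = prod_list (diag_mat (M * U))"
  proof (rule det_lower_triangular[of ?d])
    fix i j assume "i < j" "j < ?d"
    then show "(M * U) $$ (i, j) = 0" by (simp add: MU co)
  qed (use carr in auto)
  also have "\<dots> = (\<Prod>i\<in>{0..<?d}. \<Lambda> i)"
    unfolding prod_list_diag_prod using carr by (intro prod.cong) (auto simp: MU co simp del: index_mult_mat(1))
  also have "{0..<?d} = {..n}" by auto
  also have "det U = 1"
  proof -
    have "det U = prod_list (diag_mat U)"
      by (rule det_upper_triangular[of _ ?d]) (auto simp: U_def upper_triangular_def)
    also have "\<dots> = 1" unfolding prod_list_diag_prod by (rule prod.neutral) (simp add: U_def E0)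
    finally show ?thesis .
  qed
  finally show ?thesis by (simp add: M_def \<Lambda>_def)
qed

section \<open>Evaluation\<close>

lemma fact_mult_Suc: 
  "(fact (3 * Suc k) :: real) = (3 * real k + 3) * (3 * real k + 2) * (3 * real k + 1) * fact (3 * k)"
  "(fact (2 * Suc k) :: real) = (2 * real k + 2) * (2 * real k + 1) * fact (2 * k)"
  by (simp_all add: numeral_3_eq_3 numeral_2_eq_2 algebra_simps)

lemma central_ternary_Suc:
  "real ((3 * Suc k) choose Suc k) =
    3 * (3 * real k + 1) * (3 * real k + 2) / (2 * (real k + 1) * (2 * real k + 1)) * real ((3 * k) choose k)"
proof -
  have b: "real ((3 * m) choose m) = fact (3 * m) / (fact m * fact (2 * m))" for m
    using binomial_fact[of m "3 * m", where 'a = real] by simp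
  have "fact (Suc k) = (real k + 1) * fact k" by (simp add: algebra_simps)
  then show ?thesis unfolding b fact_mult_Suc
    by (simp add: divide_simps del: fact_Suc) (simp add: algebra_simps)
qed

lemma hyp_central_ternary:
  "hyp (1 / 3) (2 / 3) (1 / 2) (27 / 4) = Abs_fps (\<lambda>k. real ((3 * k) choose k))"
proof (rule fps_ext)
  fix k
  show "hyp (1 / 3) (2 / 3) (1 / 2) (27 / 4) $ k = Abs_fps (\<lambda>k. real ((3 * k) choose k)) $ k"
  proof (induction k)
    case (Suc k)
    have regroup: "(p * u) * (p' * u') / ((q * w) * (w' * f)) * (s * s') = (u * u' / (w * w') * s) * (p * p' / (q * f) * s')"
      for p u p' u' q w w' f s s' :: real
      by (simp add: mult_ac)
    have "(1 / 3 + x) * (2 / 3 + x) / ((1 / 2 + x) * (x + 1)) * (27 / 4) =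
        3 * (3 * x + 1) * (3 * x + 2) / (2 * (x + 1) * (2 * x + 1))" if "x \<ge> 0" for x :: real
      using that by (simp add: divide_simps) (simp add: algebra_simps)
    from this[of "real k"] have "hyp (1 / 3) (2 / 3) (1 / 2) (27 / 4) $ Suc k = 
      3 * (3 * real k + 1) * (3 * real k + 2) / (2 * (real k + 1) * (2 * real k + 1)) * hyp (1 / 3) (2 / 3) (1 / 2) (27 / 4) $ k"
      unfolding hyp_nth pochhammer_Suc fact_Suc power_Suc regroup by (simp add: add.commute)
    then show ?case unfolding Suc.IH fps_nth_Abs_fps central_ternary_Suc .
  qed (simp add: hyp_nth)
qed

lemma hyp_ternary_trees:
  "hyp (1 / 3) (2 / 3) (3 / 2) (27 / 4) = Abs_fps (\<lambda>k. real ((3 * k) choose k) / real (2 * k + 1))"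
proof (rule fps_ext)
  fix k
  have "(1 / 2) * pochhammer (3 / 2 :: real) k = pochhammer (1 / 2) k * (1 / 2 + real k)"
    using pochhammer_rec[of "1 / 2 :: real" k] pochhammer_Suc[of "1 / 2 :: real" k] by simp
  then have "pochhammer (3 / 2 :: real) k = pochhammer (1 / 2) k * (2 * real k + 1)" by (simp add: algebra_simps)
  then have "hyp (1 / 3) (2 / 3) (3 / 2) (27 / 4) $ k = hyp (1 / 3) (2 / 3) (1 / 2) (27 / 4) $ k / real (2 * k + 1)"
    by (simp add: hyp_nth add.commute)
  then show "hyp (1 / 3) (2 / 3) (3 / 2) (27 / 4) $ k = Abs_fps (\<lambda>k. real ((3 * k) choose k) / real (2 * k + 1)) $ k"
    by (simp add: hyp_central_ternary)
qed

text \<open>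
  The coefficients \<open>l_j\<close> of the continued fraction of \<open>A\<close>. The square of \<open>27/4\<close> comes from the argument
  \<open>27t/4\<close> of the hypergeometric series.
\<close>

definition jcoeff :: "nat \<Rightarrow> real" where
  "jcoeff j = gauss_coeff (1 / 3 + real j) (2 / 3 + real j) (3 / 2 + 2 * real j) * (27 / 4)\<^sup>2"

lemma jcoeff_eq:
  "jcoeff j = 9 * (3 * real j + 1) * (3 * real j + 2) * (6 * real j + 5) * (6 * real j + 7) /
     (4 * (4 * real j + 1) * (4 * real j + 3)\<^sup>2 * (4 * real j + 5))"
proof -
  define x where "x = real j"
  have pos: "4 * x + 1 \<noteq> 0" "4 * x + 3 \<noteq> 0" "4 * x + 5 \<noteq> 0"
    unfolding x_def by linarith+
  have "w / 3 * (v / 3) * (p / 6) * (q / 6) / (s / 2 * (t / 2)\<^sup>2 * (z / 2)) * (27 / 4)\<^sup>2 =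
      9 * w * v * q * p / (4 * s * t\<^sup>2 * z)" if "s \<noteq> 0" "t \<noteq> 0" "z \<noteq> 0" for w v p q s t z :: real
    using that by (simp add: divide_simps power2_eq_square)
  note regroup = this[OF pos]
  have params: "1 / 3 + x = (3 * x + 1) / 3" "2 / 3 + x = (3 * x + 2) / 3" "3 / 2 + 2 * x = (4 * x + 3) / 2"
    and differences: "(4 * x + 3) / 2 - (3 * x + 1) / 3 = (6 * x + 7) / 6" "(4 * x + 3) / 2 - (3 * x + 2) / 3 = (6 * x + 5) / 6"
      "(4 * x + 3) / 2 - 1 = (4 * x + 1) / 2" "(4 * x + 3) / 2 + 1 = (4 * x + 5) / 2"
    by (simp_all add: field_simps)
  show ?thesis
    unfolding jcoeff_def gauss_coeff_def x_def[symmetric] params differences by (rule regroup)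
qed

lemma prod_jcoeff:
  assumes "i \<ge> 1"
  shows "(\<Prod>j<i. jcoeff j) = (fact (2 * i - 1) * fact (6 * i + 1)) / (2 * fact (4 * i - 1) * fact (4 * i + 1))"
  using assms
proof (induction i rule: dec_induct)
  case base
  show ?case by (simp add: jcoeff_eq fact_numeral)
next
  case (step i)
  define x where "x = real i"
  have x: "x \<ge> 1" using step by (simp add: x_def)
  have n: "2 * Suc i - 1 = Suc (Suc (2 * i - 1))" "6 * Suc i + 1 = Suc (Suc (Suc (Suc (Suc (Suc (6 * i + 1))))))"
     "4 * Suc i - 1 = Suc (Suc (Suc (Suc (4 * i - 1))))" "4 * Suc i + 1 = Suc (Suc (Suc (Suc (4 * i + 1))))"
    using step by simp_all
  have f: "(fact (2 * Suc i - 1) :: real) = (2 * x + 1) * (2 * x) * fact (2 * i - 1)"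
     "(fact (6 * Suc i + 1) :: real) = (6 * x + 7) * (6 * (x + 1)) * (6 * x + 5) * (2 * (3 * x + 2)) * (3 * (2 * x + 1)) * (2 * (3 * x + 1)) * fact (6 * i + 1)"
     "(fact (4 * Suc i - 1) :: real) = (4 * x + 3) * (2 * (2 * x + 1)) * (4 * x + 1) * (4 * x) * fact (4 * i - 1)"
     "(fact (4 * Suc i + 1) :: real) = (4 * x + 5) * (4 * (x + 1)) * (4 * x + 3) * (2 * (2 * x + 1)) * fact (4 * i + 1)"
    unfolding n fact_Suc using step by (simp_all add: x_def of_nat_diff add.commute mult.assoc del: fact_Suc One_nat_def)
  have nz: "x \<noteq> 0" "x + 1 \<noteq> 0" "2 * x + 1 \<noteq> 0" "4 * x + 1 \<noteq> 0" "4 * x + 3 \<noteq> 0" "4 * x + 5 \<noteq> 0"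
    using x by auto
  have "9 * w * v * q * p / (4 * s * t\<^sup>2 * z) = u * (2 * x) * (p * (6 * y) * q * (2 * v) * (3 * u) * (2 * w)) /
      (t * (2 * u) * s * (4 * x) * (z * (4 * y) * t * (2 * u)))"
    if "x \<noteq> 0" "y \<noteq> 0" "u \<noteq> 0" "s \<noteq> 0" "t \<noteq> 0" "z \<noteq> 0" for w v q p s t z u x y :: real
    using that by (simp add: divide_simps power2_eq_square)
  note cancel = this[OF nz]
  have "(\<Prod>j<Suc i. jcoeff j) = 
    (fact (2 * i - 1) * fact (6 * i + 1)) / (2 * fact (4 * i - 1) * fact (4 * i + 1)) * jcoeff i"
    using step by simp
  also have "jcoeff i = (2 * x + 1) * (2 * x) * ((6 * x + 7) * (6 * (x + 1)) * (6 * x + 5) * (2 * (3 * x + 2)) * (3 * (2 * x + 1)) * (2 * (3 * x + 1))) /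
    ((4 * x + 3) * (2 * (2 * x + 1)) * (4 * x + 1) * (4 * x) * ((4 * x + 5) * (4 * (x + 1)) * (4 * x + 3) * (2 * (2 * x + 1))))"
    unfolding jcoeff_eq x_def[symmetric] by (rule cancel)
  finally show ?case unfolding f by (simp add: mult_ac)
qed

theorem corollary3:
  fixes n :: nat
  shows "hankel_H n (3 / 4) =
    (\<Prod>i=1..n. (fact (2 * i - 1) * fact (6 * i + 1) :: real) /
                (2 * fact (4 * i - 1) * fact (4 * i + 1)))"
proof -
  define X where "X m = hyp (1 / 3 + real m) (2 / 3 + real m) (3 / 2 + 2 * real m) (27 / 4)" for m
  define V where "V = (1 - fps_const (27 / 4) * fps_X) * hyp (1 / 3) (2 / 3) (1 / 2) (27 / 4)"
  define G where "G m = (case m of 0 \<Rightarrow> V | Suc k \<Rightarrow> X k)" for m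
  define A where "A = Abs_fps (\<lambda>k. a_poly k (3 / 4))"
  have "\<exists>b. G m = (1 - fps_const b * fps_X) * G (Suc m) - fps_const (jcoeff m) * fps_X\<^sup>2 * G (Suc (Suc m))" for m
  proof (cases m)
    case 0
    then show ?thesis
      using hyp_contiguous_base[of "1 / 2" "27 / 4" "1 / 3" "2 / 3"]
      by (auto simp: G_def V_def X_def jcoeff_def)
  next
    case (Suc k)
    have "X (Suc k) = hyp (1 / 3 + real k + 1) (2 / 3 + real k + 1) (3 / 2 + 2 * real k + 2) (27 / 4)"
         "X (Suc (Suc k)) = hyp (1 / 3 + real k + 2) (2 / 3 + real k + 2) (3 / 2 + 2 * real k + 4) (27 / 4)"
         "jcoeff m = gauss_coeff (1 / 3 + real k + 1) (2 / 3 + real k + 1) (3 / 2 + 2 * real k + 2) * (27 / 4)\<^sup>2"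
      by (simp_all add: Suc X_def jcoeff_def algebra_simps)
    moreover have "G m = X k" "G (Suc m) = X (Suc k)" "G (Suc (Suc m)) = X (Suc (Suc k))"
      by (simp_all add: Suc G_def)
    moreover have "X k = hyp (1 / 3 + real k) (2 / 3 + real k) (3 / 2 + 2 * real k) (27 / 4)"
      by (simp add: X_def)
    moreover have "3 / 2 + 2 * real k > 0" by simp
    ultimately show ?thesis
      using hyp_contiguous[of "3 / 2 + 2 * real k" "1 / 3 + real k" "2 / 3 + real k" "27 / 4"] by metis
  qed
  then obtain b where step: "\<And>m. G m = (1 - fps_const (b m) * fps_X) * G (Suc m) - 
      fps_const (jcoeff m) * fps_X\<^sup>2 * G (Suc (Suc m))"
    by metis
  have start: "A * G 0 = G (Suc 0)"
    using gf_quotient by (simp add: A_def G_def V_def X_def hyp_central_ternary hyp_ternary_trees)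
  have unit: "G m $ 0 = 1" for m
    by (auto simp: G_def V_def X_def hyp_nth split: nat.split)
  have "hankel_H n (3 / 4) = (\<Prod>i\<le>n. \<Prod>j<i. jcoeff j)"
    using hankel_det_three_term[OF step start unit, of n] by (simp add: hankel_H_def A_def)
  also have "\<dots> = (\<Prod>i=1..n. \<Prod>j<i. jcoeff j)"
    \<comment> \<open>The factor for \<open>i = 0\<close> is an empty product.\<close>
    by (rule prod.mono_neutral_right) (auto simp: not_less_eq_eq)
  also have "\<dots> = (\<Prod>i=1..n. (fact (2 * i - 1) * fact (6 * i + 1) :: real) /
                (2 * fact (4 * i - 1) * fact (4 * i + 1)))"
    by (intro prod.cong) (simp_all add: prod_jcoeff)
  finally show ?thesis .
qed

end
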